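(* Let $M\in\mathbb{N}$ be fixed and, for $m=1,\dots,M$, let $f_m(s)=\sum_{k=1}^\infty a^m_k k^{-s}$ be a Dirichlet series and $\sigma_0^m\in\mathbb{R}$ a point such that $\sum_{k=1}^\infty |a^m_k| k^{-\sigma_0^m}<\infty$ and $F_m=\sum_{k=1}^\infty |a^m_k|^2k^{-2\sigma_0^m}>0$. Put $P=\left\{\prod_{m=1}^M F_m\right\}^{1/M}$, and for $x,y,z,n\in\mathbb{N}$ with $n\geq3$ let $r=\frac{x^n+y^n}{z^n}$ and \[ D(x,y,z,n)=\lim_{\tau\to\infty}\frac1\tau\prod_{m=1}^M\left\{\int_0^{\frac{r}{P}\tau}|f_m(\sigma_0^m+it)|^2{\rm d}t\right\}^{1/M}. \] Then the following are equivalent: (i) (Fermat–Wiles theorem) there are no $x,y,z,n\in\mathbb{N}$ with $n\geq3$ and $x^n+y^n=z^n$; (ii) $D(x,y,z,n)\neq1$ for all $x,y,z,n\in\mathbb{N}$ with $n\geq3$.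
   Context: Here $a^m_k$ denotes the $k$-th coefficient of the $m$-th series (the superscript $m$ is an index, not a power). *)

theory Defs
  imports "HOL-Analysis.Analysis"
begin

text \<open>A coefficient sequence \<open>a\<close> is indexed by \<open>k \<ge> 1\<close>; the value \<open>a 0\<close> is never used.
  Series over \<open>k \<ge> 1\<close> are written with index \<open>Suc k\<close>, \<open>k \<ge> 0\<close>.\<close>

definition dirichlet_series :: "(nat \<Rightarrow> complex) \<Rightarrow> complex \<Rightarrow> complex" where
  "dirichlet_series a s = (\<Sum>k. a (Suc k) * of_nat (Suc k) powr (- s))"

definition dirichlet_abs_conv_at :: "(nat \<Rightarrow> complex) \<Rightarrow> real \<Rightarrow> bool" where
  "dirichlet_abs_conv_at a \<sigma> \<longleftrightarrow>
     summable (\<lambda>k. cmod (a (Suc k)) * real (Suc k) powr (- \<sigma>))"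

definition coeff_square_sum :: "(nat \<Rightarrow> complex) \<Rightarrow> real \<Rightarrow> real" where
  "coeff_square_sum a \<sigma> = (\<Sum>k. (cmod (a (Suc k)))\<^sup>2 * real (Suc k) powr (- 2 * \<sigma>))"

definition square_sum_geo_mean ::
    "nat \<Rightarrow> (nat \<Rightarrow> nat \<Rightarrow> complex) \<Rightarrow> (nat \<Rightarrow> real) \<Rightarrow> real" where
  "square_sum_geo_mean M a \<sigma> = (\<Prod>m=1..M. coeff_square_sum (a m) (\<sigma> m)) powr (1 / real M)"

definition fermat_ratio :: "nat \<Rightarrow> nat \<Rightarrow> nat \<Rightarrow> nat \<Rightarrow> real" where
  "fermat_ratio x y z n = (real x ^ n + real y ^ n) / real z ^ n"

definition mean_value_quotient ::
    "nat \<Rightarrow> (nat \<Rightarrow> nat \<Rightarrow> complex) \<Rightarrow> (nat \<Rightarrow> real) \<Rightarrow> nat \<Rightarrow> nat \<Rightarrow> nat \<Rightarrow> nat \<Rightarrow> real \<Rightarrow> real" where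
  "mean_value_quotient M a \<sigma> x y z n \<tau> =
     1 / \<tau> * (\<Prod>m=1..M.
       (integral {0 .. fermat_ratio x y z n / square_sum_geo_mean M a \<sigma> * \<tau>}
          (\<lambda>t. (cmod (dirichlet_series (a m) (of_real (\<sigma> m) + \<i> * of_real t)))\<^sup>2))
       powr (1 / real M))"

text \<open>\<open>Lim\<close> returns an unspecified value when the limit does not exist, so statements
  about \<open>mean_value_limit\<close> should be accompanied by existence of the limit.\<close>

definition mean_value_limit ::
    "nat \<Rightarrow> (nat \<Rightarrow> nat \<Rightarrow> complex) \<Rightarrow> (nat \<Rightarrow> real) \<Rightarrow> nat \<Rightarrow> nat \<Rightarrow> nat \<Rightarrow> nat \<Rightarrow> real" where
  "mean_value_limit M a \<sigma> x y z n = Lim at_top (mean_value_quotient M a \<sigma> x y z n)"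

end

theory Submission
  imports Defs
begin

text \<open>Substituting \<open>b k = a k * k powr - \<sigma>\<close> and \<open>\<omega> k = - ln k\<close>, the function
  \<open>f (\<sigma> + i t)\<close> becomes an absolutely convergent sum of pure oscillations \<open>b k * exp (i \<omega> k t)\<close>.
  An oscillation of nonzero frequency has mean value \<open>0\<close>, and means commute with dominated series,
  so only the diagonal of \<open>f * cnj f\<close> survives and the mean of its square modulus is \<open>F\<close>.
  Hence each integral up to \<open>c \<tau>\<close> is asymptotic to \<open>c F \<tau>\<close>, the geometric mean of these is
  \<open>c P \<tau>\<close>, and \<open>c = r / P\<close> makes the limit equal to \<open>r\<close>.\<close>

section \<open>Mean values on the half-line\<close>

text \<open>Continuity is bundled in so that every integral over a bounded interval genuinely
  exists, rather than being the default 0, and so that termwise integration is available.\<close>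

definition has_mean_value :: "(real \<Rightarrow> complex) \<Rightarrow> complex \<Rightarrow> bool" where
  "has_mean_value f L \<longleftrightarrow> continuous_on UNIV f \<and>
     ((\<lambda>T. integral {0..T} f / of_real T) \<longlongrightarrow> L) at_top"

lemma has_mean_value_const: "has_mean_value (\<lambda>_. c) c"
proof -
  have "\<forall>\<^sub>F T in at_top. c = integral {0..T} (\<lambda>_. c) / of_real T"
    using eventually_gt_at_top[of "0::real"]
    by eventually_elim (simp add: scaleR_conv_of_real)
  then show ?thesis
    unfolding has_mean_value_def using tendsto_eventually by (auto intro: Lim_transform_eventually)
qed

lemma has_mean_value_cmult:
  assumes "has_mean_value f L"
  shows "has_mean_value (\<lambda>t. c * f t) (c * L)"
  using assms tendsto_mult_left[of "\<lambda>T. integral {0..T} f / of_real T" L at_top c]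
  by (auto simp: has_mean_value_def intro!: continuous_intros)

text \<open>A nonzero frequency gives a bounded antiderivative, so its increment over {0..T} is lost
  on division by T.\<close>

lemma has_mean_value_oscillation:
  fixes \<omega> :: real
  assumes "\<omega> \<noteq> 0"
  shows "has_mean_value (\<lambda>t. exp (\<i> * of_real (\<omega> * t))) 0"
proof -
  have int: "integral {0..T} (\<lambda>t. exp (\<i> * of_real (\<omega> * t))) =
      (exp (\<i> * of_real (\<omega> * T)) - 1) / (\<i> * of_real \<omega>)" if "T \<ge> 0" for T
  proof -
    have deriv: "((\<lambda>t. exp (\<i> * of_real (\<omega> * t)) / (\<i> * of_real \<omega>)) has_vector_derivative
        exp (\<i> * of_real (\<omega> * t))) (at t within {0..T})" for t
    proof -
      \<comment> \<open>The antiderivative is differentiated on the complex plane, then restricted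
        to the real line.\<close>
      have "((\<lambda>z. exp (\<i> * of_real \<omega> * z) / (\<i> * of_real \<omega>)) has_field_derivative
          exp (\<i> * of_real \<omega> * of_real t)) (at (of_real t))"
        using assms by (auto intro!: derivative_eq_intros)
      then show ?thesis
        by (auto dest!: has_vector_derivative_real_field simp: mult.assoc)
    qed
    show ?thesis
      using fundamental_theorem_of_calculus[OF that deriv]
      by (simp add: has_integral_iff diff_divide_distrib)
  qed
  have "((\<lambda>T. 2 / \<bar>\<omega>\<bar> * inverse T) \<longlongrightarrow> 2 / \<bar>\<omega>\<bar> * 0) at_top"
    by (intro tendsto_mult_left tendsto_inverse_0_at_top filterlim_ident)
  then have lim: "((\<lambda>T. 2 / \<bar>\<omega>\<bar> / T) \<longlongrightarrow> 0) at_top"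
    by (simp add: divide_inverse)
  have "\<forall>\<^sub>F T in at_top. norm (integral {0..T} (\<lambda>t. exp (\<i> * of_real (\<omega> * t))) / of_real T)
      \<le> 2 / \<bar>\<omega>\<bar> / T"
    using eventually_gt_at_top[of "0::real"]
  proof eventually_elim
    case (elim T)
    \<comment> \<open>Two points of the unit circle are at distance at most 2.\<close>
    have "norm (exp (\<i> * of_real (\<omega> * T)) - 1) \<le> 2"
      using norm_triangle_ineq4[of "exp (\<i> * of_real (\<omega> * T))" 1]
      by (metis norm_exp_i_times norm_one one_add_one)
    with elim show ?case
      by (simp only: int norm_divide norm_mult norm_ii norm_of_real less_imp_le mult_1)
        (simp add: divide_right_mono)
  qed
  then show ?thesis
    unfolding has_mean_value_def by (auto intro!: continuous_intros Lim_null_comparison[OF _ lim])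
qed

text \<open>The Weierstrass M-test gives uniform convergence, hence continuity and termwise
  integration. Averages obey the same bounds \<open>B k\<close> uniformly in T, so Tannery's theorem
  exchanges the limit with the sum.\<close>

lemma has_mean_value_suminf:
  assumes mean: "\<And>k. has_mean_value (g k) (L k)"
    and bound: "\<And>k t. norm (g k t) \<le> B k"
    and "summable B"
  shows "has_mean_value (\<lambda>t. \<Sum>k. g k t) (\<Sum>k. L k)"
proof -
  have cont: "continuous_on A (g k)" for A k
    using mean continuous_on_subset unfolding has_mean_value_def by blast
  have unif: "uniform_limit A (\<lambda>n t. \<Sum>k<n. g k t) (\<lambda>t. \<Sum>k. g k t) sequentially" for A
    using bound \<open>summable B\<close> by (rule Weierstrass_m_test)
  have le: "norm (integral {0..T} (g k)) / T \<le> B k" if "T > 0" for T k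
    using integral_bound[of 0 T "g k" "B k"] that
    by (auto simp: cont bound divide_le_eq)
  have "continuous_on UNIV (\<lambda>t. \<Sum>k. g k t)"
    by (rule uniform_limit_theorem[OF always_eventually unif])
      (auto intro!: continuous_on_sum cont)
  moreover have "integral {0..T} (\<lambda>t. \<Sum>k. g k t) = (\<Sum>k. integral {0..T} (g k))" for T
  proof -
    obtain I J where I: "\<And>n. ((\<lambda>t. \<Sum>k<n. g k t) has_integral I n) {0..T}"
      and J: "((\<lambda>t. \<Sum>k. g k t) has_integral J) {0..T}" and "I \<longlonglongrightarrow> J"
      by (rule uniform_limit_integral[OF unif[of "{0..T}"]]) (auto intro!: continuous_on_sum cont)
    have I_eq: "I n = (\<Sum>k<n. integral {0..T} (g k))" for n
      using integral_unique[OF I[of n]]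
      by (simp add: integral_sum integrable_continuous_interval cont)
    from \<open>I \<longlonglongrightarrow> J\<close> have "(\<lambda>k. integral {0..T} (g k)) sums J"
      by (simp add: sums_def flip: I_eq)
    with J show ?thesis
      by (simp add: sums_iff integral_unique)
  qed
  moreover have "((\<lambda>T. \<Sum>k. integral {0..T} (g k) / of_real T) \<longlongrightarrow> (\<Sum>k. L k)) at_top"
  proof (rule tannerys_theorem[THEN conjunct2, THEN conjunct2])
    show "((\<lambda>T. integral {0..T} (g k) / of_real T) \<longlongrightarrow> L k) at_top" for k
      using mean by (simp add: has_mean_value_def)
    have "\<forall>\<^sub>F (k::nat, T::real) in at_top \<times>\<^sub>F at_top. 0 < T"
      by (simp add: eventually_prod2 eventually_gt_at_top)
    then show "\<forall>\<^sub>F (k, T) in at_top \<times>\<^sub>F at_top. norm (integral {0..T} (g k) / of_real T) \<le> B k"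
      by eventually_elim (auto simp: norm_divide le)
  qed (use \<open>summable B\<close> in auto)
  \<comment> \<open>The average of the sum and the sum of averages need agree only for large T; T >
    0 makes the bound on the averages available.\<close>
  moreover have "(\<Sum>k. integral {0..T} (g k) / of_real T) =
      (\<Sum>k. integral {0..T} (g k)) / of_real T" if "T > 0" for T
  proof (rule suminf_divide)
    have "norm (integral {0..T} (g k)) \<le> T * B k" for k
      using le[OF that, of k] that by (simp add: divide_le_eq mult.commute)
    then show "summable (\<lambda>k. integral {0..T} (g k))"
      using \<open>summable B\<close> by (blast intro: summable_comparison_test' summable_mult)
  qed
  then have "\<forall>\<^sub>F T in at_top. (\<Sum>k. integral {0..T} (g k) / of_real T) =
      (\<Sum>k. integral {0..T} (g k)) / of_real T"
    by (rule eventually_mono[OF eventually_gt_at_top])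
  ultimately show ?thesis
    unfolding has_mean_value_def by (auto intro: Lim_transform_eventually)
qed

section \<open>Parseval identity for absolutely convergent oscillation sums\<close>

text \<open>The product of f and its conjugate is expanded one factor at a time, so that two uses of
  the single-series lemma replace a double series.\<close>

lemma has_mean_value_square_oscillation_sum:
  fixes b :: "nat \<Rightarrow> complex" and \<omega> :: "nat \<Rightarrow> real"
  assumes "summable (\<lambda>k. norm (b k))" and "inj \<omega>"
  defines "f \<equiv> \<lambda>t. \<Sum>k. b k * exp (\<i> * of_real (\<omega> k * t))"
  shows "has_mean_value (\<lambda>t. of_real ((norm (f t))\<^sup>2)) (\<Sum>k. of_real ((norm (b k))\<^sup>2))"
proof -
  define e where "e = (\<lambda>k t. b k * exp (\<i> * of_real (\<omega> k * t)))"
  have f: "f = (\<lambda>t. \<Sum>k. e k t)"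
    by (simp add: f_def e_def)
  have norm_e: "norm (e k t) = norm (b k)" for k t
    by (simp only: e_def norm_mult norm_exp_i_times mult_1_right)
  have summable_e: "summable (\<lambda>k. e k t)" for t
    using assms(1) by (auto simp: norm_e intro: summable_norm_cancel)
  have norm_f: "norm (f t) \<le> (\<Sum>k. norm (b k))" for t
    using summable_norm[of "\<lambda>k. e k t"] assms(1) by (simp only: norm_e f)
  \<comment> \<open>The product oscillates with frequency \<open>\<omega> j - \<omega> k\<close>,
    which vanishes only on the diagonal because \<open>\<omega>\<close> is injective.\<close>
  have pair: "has_mean_value (\<lambda>t. e j t * cnj (e k t)) (if j = k then of_real ((norm (b k))\<^sup>2) else 0)"
    for j k
  proof -
    have eq: "e j t * cnj (e k t) = b j * cnj (b k) * exp (\<i> * of_real ((\<omega> j - \<omega> k) * t))"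
      for j k t
      by (simp add: e_def exp_cnj algebra_simps exp_diff exp_minus divide_inverse)
    show ?thesis
    proof (cases "j = k")
      case True
      then show ?thesis
        using has_mean_value_const[of "b k * cnj (b k)"]
        by (simp only: eq complex_norm_square) simp
    next
      case False
      with \<open>inj \<omega>\<close> have "\<omega> j - \<omega> k \<noteq> 0"
        by (auto dest: injD)
      from has_mean_value_cmult[OF has_mean_value_oscillation[OF this]] False show ?thesis
        by (simp only: eq if_False mult_zero_right)
    qed
  qed
  \<comment> \<open>Only the conjugate factor is a single term here; summing over j leaves just the
    contribution of j = k.\<close>
  have row: "has_mean_value (\<lambda>t. f t * cnj (e k t)) (of_real ((norm (b k))\<^sup>2))" for k
  proof -
    have "has_mean_value (\<lambda>t. \<Sum>j. e j t * cnj (e k t))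
        (\<Sum>j. if j = k then of_real ((norm (b k))\<^sup>2) else 0)"
      by (rule has_mean_value_suminf[OF pair, where B = "\<lambda>j. norm (b j) * norm (b k)"])
        (simp_all add: norm_mult norm_e summable_mult2 assms(1))
    moreover have "(\<Sum>j. if j = k then of_real ((norm (b k))\<^sup>2) else 0) = (of_real ((norm (b k))\<^sup>2) :: complex)"
      using sums_single[of k "\<lambda>_. of_real ((norm (b k))\<^sup>2) :: complex"] by (simp add: sums_iff)
    ultimately show ?thesis
      using summable_e by (simp only: f suminf_mult2)
  qed
  \<comment> \<open>The second summation is dominated because \<open>norm_f\<close> bounds f
    uniformly in t.\<close>
  have "has_mean_value (\<lambda>t. \<Sum>k. f t * cnj (e k t)) (\<Sum>k. of_real ((norm (b k))\<^sup>2))"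
    by (rule has_mean_value_suminf[OF row, where B = "\<lambda>k. (\<Sum>k. norm (b k)) * norm (b k)"])
      (auto simp: norm_mult norm_e assms(1) intro!: mult_right_mono norm_f summable_mult)
  moreover have "(\<Sum>k. f t * cnj (e k t)) = of_real ((norm (f t))\<^sup>2)" for t
  proof -
    have "(\<lambda>k. f t * cnj (e k t)) sums (f t * cnj (f t))"
      using summable_e by (auto simp: sums_cnj f intro!: sums_mult summable_sums)
    then show ?thesis
      by (metis complex_norm_square sums_unique)
  qed
  ultimately show ?thesis
    by simp
qed

section \<open>Mean squares of Dirichlet series on vertical lines\<close>

lemma dirichlet_series_mean_square:
  assumes "dirichlet_abs_conv_at a \<sigma>"
  shows "((\<lambda>T. integral {0..T} (\<lambda>t. (cmod (dirichlet_series a (of_real \<sigma> + \<i> * of_real t)))\<^sup>2) / T)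
    \<longlongrightarrow> coeff_square_sum a \<sigma>) at_top"
proof -
  define b where "b = (\<lambda>k. a (Suc k) * of_real (real (Suc k) powr - \<sigma>))"
  define \<omega> where "\<omega> = (\<lambda>k. - ln (real (Suc k)))"
  define g where "g = (\<lambda>t. (cmod (dirichlet_series a (of_real \<sigma> + \<i> * of_real t)))\<^sup>2)"
  have norm_b: "norm (b k) = cmod (a (Suc k)) * real (Suc k) powr - \<sigma>" for k
    by (simp add: b_def norm_mult del: of_nat_Suc)
  have summable_b: "summable (\<lambda>k. norm (b k))"
    using assms by (simp only: norm_b dirichlet_abs_conv_at_def)
  have sq: "(norm (b k))\<^sup>2 = (cmod (a (Suc k)))\<^sup>2 * real (Suc k) powr (- 2 * \<sigma>)" for k
  proof -
    have "(real (Suc k) powr - \<sigma>)\<^sup>2 = real (Suc k) powr (- \<sigma> * 2)"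
      by (simp only: powr_powr[symmetric]) (simp del: of_nat_Suc)
    then show ?thesis
      by (simp add: norm_b power_mult_distrib mult.commute del: of_nat_Suc)
  qed
  \<comment> \<open>The terms \<open>norm (b k)\<close> tend to 0, so their squares are eventually
    smaller than the terms themselves. Summability is what later identifies the complex sum of
    squares with the real one.\<close>
  have "summable (\<lambda>k. (norm (b k))\<^sup>2)"
  proof (rule summable_comparison_test_ev[OF _ summable_b])
    have "\<forall>\<^sub>F k in sequentially. norm (b k) < 1"
      using summable_LIMSEQ_zero[OF summable_b] by (rule order_tendstoD) simp
    then show "\<forall>\<^sub>F k in sequentially. norm ((norm (b k))\<^sup>2) \<le> norm (b k)"
      by eventually_elim (simp add: power2_eq_square mult_left_le)
  qed
  \<comment> \<open>On the positive real base \<open>Suc k\<close> the complex logarithm is the real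
    one, so the power splits into modulus and phase.\<close>
  have term_eq: "a (Suc k) * of_nat (Suc k) powr - (of_real \<sigma> + \<i> * of_real t) =
      b k * exp (\<i> * of_real (\<omega> k * t))" for k t
  proof -
    have "of_nat (Suc k) powr - (of_real \<sigma> + \<i> * of_real t) =
        exp (of_real (- \<sigma> * ln (real (Suc k))) + \<i> * of_real (\<omega> k * t))"
      using Ln_of_real[of "real (Suc k)"]
      by (simp add: powr_def \<omega>_def algebra_simps del: of_nat_Suc)
    also have "\<dots> = of_real (real (Suc k) powr - \<sigma>) * exp (\<i> * of_real (\<omega> k * t))"
      by (simp only: exp_add exp_of_real) (simp add: powr_def del: of_nat_Suc)
    finally show ?thesis
      by (simp add: b_def)
  qed
  have "inj \<omega>"
    by (auto simp: inj_on_def \<omega>_def)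
  from has_mean_value_square_oscillation_sum[OF summable_b this]
  have mean: "has_mean_value (\<lambda>t. of_real (g t)) (\<Sum>k. of_real ((norm (b k))\<^sup>2))"
    by (simp only: g_def dirichlet_series_def term_eq)
  \<comment> \<open>Back to the reals: g is continuous, hence integrable, so its integral commutes
    with the embedding into the complex numbers.\<close>
  then have "continuous_on UNIV g"
    using continuous_on_Re[of UNIV "\<lambda>t. of_real (g t)"] by (simp add: has_mean_value_def)
  then have "g integrable_on {0..T}" for T
    by (auto intro!: integrable_continuous_interval elim: continuous_on_subset)
  then have "integral {0..T} (\<lambda>t. of_real (g t)) = (of_real (integral {0..T} g) :: complex)" for T
    by (rule integral_unique[OF has_integral_of_real[OF integrable_integral]])
  with mean have "((\<lambda>T. of_real (integral {0..T} g / T)) \<longlongrightarrow> (\<Sum>k. of_real ((norm (b k))\<^sup>2) :: complex)) at_top"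
    by (simp add: has_mean_value_def)
  then have "((\<lambda>T. Re (of_real (integral {0..T} g / T))) \<longlongrightarrow> Re (\<Sum>k. of_real ((norm (b k))\<^sup>2))) at_top"
    by (rule tendsto_Re)
  moreover have "Re (\<Sum>k. of_real ((norm (b k))\<^sup>2)) = coeff_square_sum a \<sigma>"
    using \<open>summable (\<lambda>k. (norm (b k))\<^sup>2)\<close>
    by (simp only: suminf_of_real[symmetric] Re_complex_of_real coeff_square_sum_def sq)
  ultimately show ?thesis
    by (simp add: g_def)
qed

section \<open>The limit of the normalised geometric mean\<close>

lemma mean_value_quotient_tendsto:
  assumes "M \<ge> 1"
    and conv: "\<And>m. m \<in> {1..M} \<Longrightarrow> dirichlet_abs_conv_at (a m) (\<sigma> m)"
    and pos: "\<And>m. m \<in> {1..M} \<Longrightarrow> coeff_square_sum (a m) (\<sigma> m) > 0"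
    and "x \<ge> 1" "z \<ge> 1"
  shows "(mean_value_quotient M a \<sigma> x y z n \<longlongrightarrow> fermat_ratio x y z n) at_top"
proof -
  define P where "P = square_sum_geo_mean M a \<sigma>"
  define c where "c = fermat_ratio x y z n / P"
  define J where "J = (\<lambda>m T. integral {0..T}
    (\<lambda>t. (cmod (dirichlet_series (a m) (of_real (\<sigma> m) + \<i> * of_real t)))\<^sup>2))"
  have "P > 0"
    using prod_pos[of "{1..M}" "\<lambda>m. coeff_square_sum (a m) (\<sigma> m)"] pos
    by (force simp: P_def square_sum_geo_mean_def)
  \<comment> \<open>Positivity of the ratio ensures that the upper limit \<open>c * \<tau>\<close>
    of integration tends to infinity.\<close>
  have "fermat_ratio x y z n > 0"
    using \<open>x \<ge> 1\<close> \<open>z \<ge> 1\<close> by (simp add: fermat_ratio_def add_pos_nonneg)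
  with \<open>P > 0\<close> have "c > 0"
    by (simp add: c_def)
  \<comment> \<open>The geometric mean of M equal positive numbers; it serves for d = c in the limit
    and for d = 1 / \<tau> in the prefactor.\<close>
  have geo_mean_const: "(\<Prod>m=1..M. d powr (1 / real M)) = d" if "d > 0" for d :: real
    using \<open>M \<ge> 1\<close> that by (simp add: powr_realpow[symmetric] powr_powr)
  have scale: "filterlim (\<lambda>\<tau>. c * \<tau>) at_top at_top"
    using \<open>c > 0\<close> filterlim_tendsto_pos_mult_at_top[OF tendsto_const _ filterlim_ident] by blast
  \<comment> \<open>Each integral divided by \<tau> is written as c times an average over an
    interval of length \<open>c * \<tau>\<close>.\<close>
  have "((\<lambda>\<tau>. \<Prod>m=1..M. (c * (J m (c * \<tau>) / (c * \<tau>))) powr (1 / real M)) \<longlongrightarrow>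
      (\<Prod>m=1..M. (c * coeff_square_sum (a m) (\<sigma> m)) powr (1 / real M))) at_top"
  proof (intro tendsto_prod tendsto_powr tendsto_mult tendsto_const)
    fix m assume m: "m \<in> {1..M}"
    show "((\<lambda>\<tau>. J m (c * \<tau>) / (c * \<tau>)) \<longlongrightarrow> coeff_square_sum (a m) (\<sigma> m)) at_top"
      unfolding J_def by (rule filterlim_compose[OF dirichlet_series_mean_square[OF conv[OF m]] scale])
    \<comment> \<open>Continuity of the power at the limiting base requires that base to be nonzero,
      which is where F_m > 0 enters.\<close>
    show "c * coeff_square_sum (a m) (\<sigma> m) \<noteq> 0"
      using \<open>c > 0\<close> pos[OF m] by simp
  qed
  also have "(\<Prod>m=1..M. (c * coeff_square_sum (a m) (\<sigma> m)) powr (1 / real M)) = c * P"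
    unfolding P_def square_sum_geo_mean_def
    using \<open>c > 0\<close> pos
    by (simp only: powr_mult prod.distrib geo_mean_const prod_powr_distrib)
  also have "c * P = fermat_ratio x y z n"
    using \<open>P > 0\<close> by (simp add: c_def)
  finally have lim: "((\<lambda>\<tau>. \<Prod>m=1..M. (c * (J m (c * \<tau>) / (c * \<tau>))) powr (1 / real M)) \<longlongrightarrow>
      fermat_ratio x y z n) at_top" .
  have "(\<Prod>m=1..M. (c * (J m (c * \<tau>) / (c * \<tau>))) powr (1 / real M)) =
      mean_value_quotient M a \<sigma> x y z n \<tau>" if "\<tau> > 0" for \<tau>
  proof -
    have "c * (J m (c * \<tau>) / (c * \<tau>)) = 1 / \<tau> * J m (c * \<tau>)" for m
      using \<open>c > 0\<close> by simp
    then have "(\<Prod>m=1..M. (c * (J m (c * \<tau>) / (c * \<tau>))) powr (1 / real M)) =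
        (\<Prod>m=1..M. (1 / \<tau>) powr (1 / real M)) * (\<Prod>m=1..M. J m (c * \<tau>) powr (1 / real M))"
      by (simp only: powr_mult prod.distrib)
    also have "(\<Prod>m=1..M. (1 / \<tau>) powr (1 / real M)) = 1 / \<tau>"
      using that by (intro geo_mean_const) simp
    finally show ?thesis
      by (simp only: mean_value_quotient_def J_def c_def P_def)
  qed
  then have "\<forall>\<^sub>F \<tau> in at_top. (\<Prod>m=1..M. (c * (J m (c * \<tau>) / (c * \<tau>))) powr (1 / real M)) =
      mean_value_quotient M a \<sigma> x y z n \<tau>"
    by (rule eventually_mono[OF eventually_gt_at_top])
  with lim show ?thesis
    by (rule Lim_transform_eventually)
qed

lemma fermat_ratio_eq_1_iff:
  assumes "z \<ge> 1"
  shows "fermat_ratio x y z n = 1 \<longleftrightarrow> x ^ n + y ^ n = z ^ n"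
proof -
  have "fermat_ratio x y z n = 1 \<longleftrightarrow> real (x ^ n + y ^ n) = real (z ^ n)"
    using assms by (auto simp: fermat_ratio_def)
  then show ?thesis
    by (simp only: of_nat_eq_iff)
qed

text \<open>The limit is r, so it equals 1 exactly when the Fermat equation holds for the same x, y,
  z, n; the equivalence follows quadruple by quadruple.\<close>

theorem theorem3:
  fixes M :: nat
    and a :: "nat \<Rightarrow> nat \<Rightarrow> complex"
    and \<sigma> :: "nat \<Rightarrow> real"
  assumes "M \<ge> 1"
    and "\<And>m. m \<in> {1..M} \<Longrightarrow> dirichlet_abs_conv_at (a m) (\<sigma> m)"
    and "\<And>m. m \<in> {1..M} \<Longrightarrow> coeff_square_sum (a m) (\<sigma> m) > 0"
  shows "(\<forall>(x::nat) (y::nat) (z::nat) (n::nat). x \<ge> 1 \<and> y \<ge> 1 \<and> z \<ge> 1 \<and> n \<ge> 3 \<longrightarrow>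
            (\<exists>L. (mean_value_quotient M a \<sigma> x y z n \<longlongrightarrow> L) at_top)) \<and>
         ((\<not> (\<exists>(x::nat) (y::nat) (z::nat) (n::nat).
             x \<ge> 1 \<and> y \<ge> 1 \<and> z \<ge> 1 \<and> n \<ge> 3 \<and> x ^ n + y ^ n = z ^ n)) \<longleftrightarrow>
          (\<forall>(x::nat) (y::nat) (z::nat) (n::nat). x \<ge> 1 \<and> y \<ge> 1 \<and> z \<ge> 1 \<and> n \<ge> 3 \<longrightarrow>
             mean_value_limit M a \<sigma> x y z n \<noteq> 1))"
proof -
  have lim: "(mean_value_quotient M a \<sigma> x y z n \<longlongrightarrow> fermat_ratio x y z n) at_top"
    if "x \<ge> 1" "z \<ge> 1" for x y z n
    using assms that by (rule mean_value_quotient_tendsto)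
  \<comment> \<open>Convergence pins down the value of \<open>Lim\<close>, since
    \<open>at_top\<close> is a nontrivial filter and limits are unique.\<close>
  have "mean_value_limit M a \<sigma> x y z n = fermat_ratio x y z n" if "x \<ge> 1" "z \<ge> 1" for x y z n
    unfolding mean_value_limit_def using lim[OF that] by (intro tendsto_Lim) auto
  then have "mean_value_limit M a \<sigma> x y z n = 1 \<longleftrightarrow> x ^ n + y ^ n = z ^ n"
    if "x \<ge> 1" "z \<ge> 1" for x y z n
    using that by (simp add: fermat_ratio_eq_1_iff)
  with lim show ?thesis
    by blast
qed

end
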